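(* For every partition $\lambda$ and positive integer $k$, there is a bijection between $\mathrm{BSSYT}(\lambda,k)$ and the set of triples $(Q,j,C')$ with $Q\in\mathrm{RPP}(\lambda,k)$, $1\le j\le k$, and $C'$ a proper outside corner of the induced subshape $\alpha(Q,j)$. That is, each barely set-valued tableau in $\mathrm{BSSYT}(\lambda,k)$ is uniquely represented by such a triple.
   Context: A partition $\lambda$ is identified with its Young diagram (square $(s,t)$ in row $s$, column $t$, rows numbered from the top). A set-valued semistandard Young tableau of shape $\lambda$ assigns a nonempty finite set of positive integers to each square such that for horizontally adjacent sets $A$ (left), $B$ (right), $\max A\le\min B$, and for vertically adjacent $A$ (above), $B$ (below), $\max A<\min B$; it is barely set-valued if exactly one square has a set of size two and all others have size one. $\mathrm{BSSYT}(\lambda,k)$ is the set of barely set-valued semistandard Young tableaux of shape $\lambda$ with every integer in row $s$ at most $k+s$. $\mathrm{RPP}(\lambda,k)$ is the set of reverse plane partitions of shape $\lambda$ with entries in $\{0,1,\dots,k\}$ (weakly increasing along rows and down columns). For $Q\in\mathrm{RPP}(\lambda,k)$ and $1\le j\le k$, $\alpha(Q,j)$ is the subshape consisting of the squares of $Q$ with entries strictly less than $j$. A proper outside corner of a subshape $\mu\subseteq\lambda$ is a square $(s,t)\in\lambda\setminus\mu$ such that ($s=1$ or $(s-1,t)\in\mu$) and ($t=1$ or $(s,t-1)\in\mu$). *)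

theory Defs
  imports Main "HOL-Library.FuncSet"
begin

definition integer_partition :: "nat list \<Rightarrow> bool" where
  "integer_partition lam \<longleftrightarrow> sorted_wrt (\<ge>) lam \<and> (\<forall>x\<in>set lam. 0 < x)"

text \<open>Rows and columns are numbered from 1; a square is the pair (row, column).\<close>

definition young_diagram :: "nat list \<Rightarrow> (nat \<times> nat) set" where
  "young_diagram lam = {(s, t). 1 \<le> s \<and> s \<le> length lam \<and> 1 \<le> t \<and> t \<le> lam ! (s - 1)}"

text \<open>Fillings are extensional functions (\<open>undefined\<close> off the diagram), so that two
  fillings are equal as functions iff they agree on the diagram.\<close>

definition SVT :: "nat list \<Rightarrow> (nat \<times> nat \<Rightarrow> nat set) set" where
  "SVT lam = {T \<in> young_diagram lam \<rightarrow>\<^sub>E {A. finite A \<and> A \<noteq> {} \<and> (\<forall>x\<in>A. 0 < x)}.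
     (\<forall>s t. (s, t) \<in> young_diagram lam \<and> (s, t + 1) \<in> young_diagram lam
        \<longrightarrow> Max (T (s, t)) \<le> Min (T (s, t + 1))) \<and>
     (\<forall>s t. (s, t) \<in> young_diagram lam \<and> (s + 1, t) \<in> young_diagram lam
        \<longrightarrow> Max (T (s, t)) < Min (T (s + 1, t)))}"

definition barely_set_valued :: "nat list \<Rightarrow> (nat \<times> nat \<Rightarrow> nat set) \<Rightarrow> bool" where
  "barely_set_valued lam T \<longleftrightarrow>
     (\<exists>c\<in>young_diagram lam. card (T c) = 2 \<and> (\<forall>d\<in>young_diagram lam - {c}. card (T d) = 1))"

definition BSSYT :: "nat list \<Rightarrow> nat \<Rightarrow> (nat \<times> nat \<Rightarrow> nat set) set" where
  "BSSYT lam k = {T \<in> SVT lam. barely_set_valued lam T \<and>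
     (\<forall>(s, t)\<in>young_diagram lam. \<forall>x\<in>T (s, t). x \<le> k + s)}"

definition RPP :: "nat list \<Rightarrow> nat \<Rightarrow> (nat \<times> nat \<Rightarrow> nat) set" where
  "RPP lam k = {Q \<in> young_diagram lam \<rightarrow>\<^sub>E {0..k}.
     (\<forall>s t. (s, t) \<in> young_diagram lam \<and> (s, t + 1) \<in> young_diagram lam
        \<longrightarrow> Q (s, t) \<le> Q (s, t + 1)) \<and>
     (\<forall>s t. (s, t) \<in> young_diagram lam \<and> (s + 1, t) \<in> young_diagram lam
        \<longrightarrow> Q (s, t) \<le> Q (s + 1, t))}"

definition alpha :: "nat list \<Rightarrow> (nat \<times> nat \<Rightarrow> nat) \<Rightarrow> nat \<Rightarrow> (nat \<times> nat) set" where
  "alpha lam Q j = {c \<in> young_diagram lam. Q c < j}"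

definition proper_outside_corners :: "nat list \<Rightarrow> (nat \<times> nat) set \<Rightarrow> (nat \<times> nat) set" where
  "proper_outside_corners lam \<mu> = {(s, t). (s, t) \<in> young_diagram lam - \<mu> \<and>
     (s = 1 \<or> (s - 1, t) \<in> \<mu>) \<and> (t = 1 \<or> (s, t - 1) \<in> \<mu>)}"

end

theory Submission
  imports Defs
begin

text \<open>In column-strict tableaux every entry of row \<open>s\<close> is at least \<open>s\<close>, so subtracting the row
  index turns tableaux flagged by \<open>k + s\<close> into reverse plane partitions with entries in
  \<open>{0..k}\<close>. For a barely set-valued tableau keep the larger entry of the doubled square \<open>C'\<close>, and
  record the smaller one \<open>a\<close> by \<open>j = a - s + 1\<close>. Then \<open>C'\<close> has entry at least \<open>j\<close> in \<open>Q\<close>, and the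
  tableau inequalities above and to the left of \<open>C'\<close> say precisely that these neighbours have
  entries less than \<open>j\<close>, i.e. that \<open>C'\<close> is a proper outside corner of \<open>alpha lam Q j\<close>.\<close>

text \<open>The map is defined on triples, where it is an explicit formula. For
  \<open>1 \<le> j\<close> the truncated subtraction \<open>j - 1\<close> is exact.\<close>

definition tableau_of_triple ::
    "nat list \<Rightarrow> (nat \<times> nat \<Rightarrow> nat) \<times> nat \<times> (nat \<times> nat) \<Rightarrow> (nat \<times> nat \<Rightarrow> nat set)" where
  "tableau_of_triple lam = (\<lambda>(Q, j, c). \<lambda>d\<in>young_diagram lam.
     if d = c then {j - 1 + fst d, Q d + fst d} else {Q d + fst d})"

definition corner_triples ::
    "nat list \<Rightarrow> nat \<Rightarrow> ((nat \<times> nat \<Rightarrow> nat) \<times> nat \<times> (nat \<times> nat)) set" where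
  "corner_triples lam k = {(Q, j, C'). Q \<in> RPP lam k \<and> 1 \<le> j \<and> j \<le> k \<and>
     C' \<in> proper_outside_corners lam (alpha lam Q j)}"

lemma young_diagram_pos:
  "(s, t) \<in> young_diagram lam \<Longrightarrow> 1 \<le> s \<and> 1 \<le> t"
  by (simp add: young_diagram_def)

lemma young_diagram_left:
  "(s, Suc t) \<in> young_diagram lam \<Longrightarrow> 1 \<le> t \<Longrightarrow> (s, t) \<in> young_diagram lam"
  by (simp add: young_diagram_def)

lemma young_diagram_up:
  assumes "integer_partition lam" "(Suc s, t) \<in> young_diagram lam" "1 \<le> s"
  shows "(s, t) \<in> young_diagram lam"
proof -
  have "lam ! s \<le> lam ! (s - 1)"
    using assms sorted_wrt_nth_less[of "(\<ge>)" lam "s - 1" s]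
    by (auto simp: integer_partition_def young_diagram_def)
  then show ?thesis using assms by (auto simp: young_diagram_def)
qed

lemma SVT_D:
  assumes "T \<in> SVT lam" "d \<in> young_diagram lam"
  shows "finite (T d)" "T d \<noteq> {}" "\<And>x. x \<in> T d \<Longrightarrow> 0 < x"
  using assms by (auto simp: SVT_def)

lemma SVT_row:
  assumes "T \<in> SVT lam" "(s, t) \<in> young_diagram lam" "(s, Suc t) \<in> young_diagram lam"
  shows "Max (T (s, t)) \<le> Min (T (s, Suc t))"
  using assms by (auto simp: SVT_def)

lemma SVT_col:
  assumes "T \<in> SVT lam" "(s, t) \<in> young_diagram lam" "(Suc s, t) \<in> young_diagram lam"
  shows "Max (T (s, t)) < Min (T (Suc s, t))"
  using assms by (auto simp: SVT_def)

text \<open>Induction down the column: entries in the first row are positive, and each step down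
  increases strictly. This makes the later subtraction of the row index from an entry exact.\<close>

lemma SVT_entry_ge_row:
  assumes "integer_partition lam" "T \<in> SVT lam" "(s, t) \<in> young_diagram lam" "x \<in> T (s, t)"
  shows "s \<le> x"
  using assms(3,4)
proof (induction s arbitrary: x)
  case (Suc s)
  show ?case
  proof (cases "s = 0")
    case True
    then show ?thesis using SVT_D(3)[OF assms(2) Suc.prems] by simp
  next
    case False
    then have up: "(s, t) \<in> young_diagram lam"
      using young_diagram_up[OF assms(1) Suc.prems(1)] by simp
    have "Max (T (s, t)) \<in> T (s, t)"
      using SVT_D[OF assms(2) up] by simp
    then have "s \<le> Max (T (s, t))" using Suc.IH up by blast
    also have "\<dots> < Min (T (Suc s, t))" by (rule SVT_col[OF assms(2) up Suc.prems(1)])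
    also have "\<dots> \<le> x" using SVT_D[OF assms(2) Suc.prems(1)] Suc.prems(2) by simp
    finally show ?thesis by simp
  qed
qed simp

text \<open>The bound \<open>j \<le> Q c\<close> says that \<open>c\<close> lies outside
  \<open>alpha lam Q j\<close>. The last two facts are the corner conditions, indexed by successors
  to match the row and column inequalities of tableaux.\<close>

lemma corner_triplesD:
  assumes "(Q, j, c) \<in> corner_triples lam k"
  shows "Q \<in> RPP lam k" "1 \<le> j" "j \<le> k" "c \<in> young_diagram lam" "j \<le> Q c"
    and "\<And>s t. c = (s, Suc t) \<Longrightarrow> 1 \<le> t \<Longrightarrow> Q (s, t) < j"
    and "\<And>s t. c = (Suc s, t) \<Longrightarrow> 1 \<le> s \<Longrightarrow> Q (s, t) < j"
  using assms by (auto simp: corner_triples_def proper_outside_corners_def alpha_def)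

lemma RPP_D:
  assumes "Q \<in> RPP lam k"
  shows "Q \<in> extensional (young_diagram lam)"
    and "\<And>d. d \<in> young_diagram lam \<Longrightarrow> Q d \<le> k"
    and "\<And>s t. (s, t) \<in> young_diagram lam \<Longrightarrow> (s, Suc t) \<in> young_diagram lam
           \<Longrightarrow> Q (s, t) \<le> Q (s, Suc t)"
    and "\<And>s t. (s, t) \<in> young_diagram lam \<Longrightarrow> (Suc s, t) \<in> young_diagram lam
           \<Longrightarrow> Q (s, t) \<le> Q (Suc s, t)"
  using assms by (auto simp: RPP_def PiE_def)

text \<open>At \<open>c\<close>, \<open>j - 1 < Q c\<close> orders the two entries and keeps them
  distinct.\<close>

lemma tableau_of_triple_stats:
  assumes "(Q, j, c) \<in> corner_triples lam k" "d \<in> young_diagram lam"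
  defines "A \<equiv> tableau_of_triple lam (Q, j, c) d"
  shows "finite A" "A \<noteq> {}"
    and "Max A = Q d + fst d"
    and "Min A = (if d = c then j - 1 + fst d else Q d + fst d)"
    and "card A = (if d = c then 2 else 1)"
  using corner_triplesD(2,5)[OF assms(1)] assms(2)
  by (auto simp: A_def tableau_of_triple_def)

lemma tableau_of_triple_in_BSSYT:
  assumes "(Q, j, c) \<in> corner_triples lam k"
  shows "tableau_of_triple lam (Q, j, c) \<in> BSSYT lam k"
proof -
  note C = corner_triplesD[OF assms]
  note R = RPP_D[OF C(1)]
  note S = tableau_of_triple_stats[OF assms]
  let ?T = "tableau_of_triple lam (Q, j, c)"
  let ?D = "young_diagram lam"
  have bounds: "0 < x \<and> x \<le> k + fst d" if "d \<in> ?D" "x \<in> ?T d" for d x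
    using that C(3) R(2)[OF that(1)] young_diagram_pos[of "fst d" "snd d" lam]
    by (auto simp: tableau_of_triple_def split: if_splits)
  have "?T \<in> ?D \<rightarrow>\<^sub>E {A. finite A \<and> A \<noteq> {} \<and> (\<forall>x\<in>A. 0 < x)}"
  proof (rule PiE_I)
    fix d assume "d \<in> ?D"
    then show "?T d \<in> {A. finite A \<and> A \<noteq> {} \<and> (\<forall>x\<in>A. 0 < x)}"
      using S(1,2) bounds by blast
  qed (simp add: tableau_of_triple_def)
  \<comment> \<open>Only a right square equal to \<open>c\<close> needs more than monotonicity of
    \<open>Q\<close>, since doubling lowers the minimum but keeps the maximum. There the corner
    condition gives \<open>Q (s, t) \<le> j - 1\<close>.\<close>
  moreover have "Max (?T (s, t)) \<le> Min (?T (s, Suc t))"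
    if "(s, t) \<in> ?D" "(s, Suc t) \<in> ?D" for s t
    using S(3)[OF that(1)] S(4)[OF that(2)] R(3)[OF that] C(6)[of s t]
      young_diagram_pos[OF that(1)] by (auto split: if_splits)
  moreover have "Max (?T (s, t)) < Min (?T (Suc s, t))"
    if "(s, t) \<in> ?D" "(Suc s, t) \<in> ?D" for s t
    using S(3)[OF that(1)] S(4)[OF that(2)] R(4)[OF that] C(7)[of s t]
      young_diagram_pos[OF that(1)] by (auto split: if_splits)
  ultimately have "?T \<in> SVT lam" by (simp add: SVT_def)
  moreover have "barely_set_valued lam ?T"
    unfolding barely_set_valued_def using C(4) S(5) by auto
  ultimately show ?thesis using bounds by (fastforce simp: BSSYT_def)
qed

text \<open>Cardinalities recover \<open>c\<close>, the minimum at \<open>c\<close> recovers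
  \<open>j\<close>, and the maxima recover \<open>Q\<close>.\<close>

lemma inj_on_tableau_of_triple:
  "inj_on (tableau_of_triple lam) (corner_triples lam k)"
proof -
  have "(Q, j, c) = (Q', j', c')"
    if a: "(Q, j, c) \<in> corner_triples lam k" and a': "(Q', j', c') \<in> corner_triples lam k"
      and eq: "tableau_of_triple lam (Q, j, c) = tableau_of_triple lam (Q', j', c')"
    for Q Q' j j' c c'
  proof -
    note C = corner_triplesD[OF a] and C' = corner_triplesD[OF a']
    note S = tableau_of_triple_stats[OF a] and S' = tableau_of_triple_stats[OF a']
    have c: "c = c'"
      using S(5)[OF C(4)] S'(5)[OF C(4)] eq by (simp split: if_splits)
    have j: "j = j'"
      using S(4)[OF C(4)] S'(4)[OF C(4)] eq c C(2) C'(2) by simp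
    have "Q = Q'"
    proof (rule extensionalityI)
      show "Q d = Q' d" if "d \<in> young_diagram lam" for d
        using S(3)[OF that] S'(3)[OF that] eq by simp
    qed (fact RPP_D(1)[OF C(1)] RPP_D(1)[OF C'(1)])+
    then show ?thesis using c j by simp
  qed
  then show ?thesis by (force intro!: inj_onI)
qed

lemma BSSYT_in_image:
  assumes lam: "integer_partition lam" and T: "T \<in> BSSYT lam k"
  shows "T \<in> tableau_of_triple lam ` corner_triples lam k"
proof -
  let ?D = "young_diagram lam"
  have SVT: "T \<in> SVT lam" and bound: "\<And>d x. d \<in> ?D \<Longrightarrow> x \<in> T d \<Longrightarrow> x \<le> k + fst d"
    using T by (auto simp: BSSYT_def)
  note V = SVT_D[OF SVT]
  obtain c where c: "c \<in> ?D" "card (T c) = 2"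
    and single: "\<And>d. d \<in> ?D \<Longrightarrow> d \<noteq> c \<Longrightarrow> card (T d) = 1"
    using T by (auto simp: BSSYT_def barely_set_valued_def)
  define Q where "Q = (\<lambda>d\<in>?D. Max (T d) - fst d)"
  define j where "j = Min (T c) - fst c + 1"
  have ge: "fst d \<le> x" if "d \<in> ?D" "x \<in> T d" for d x
    using SVT_entry_ge_row[OF lam SVT, of "fst d" "snd d" x] that by simp
  have Max: "Max (T d) = Q d + fst d" if "d \<in> ?D" for d
    using that ge[OF that Max_in] V[OF that] by (simp add: Q_def)
  have Min: "Min (T c) = j - 1 + fst c"
    using ge[OF c(1) Min_in] V[OF c(1)] by (simp add: j_def)
  have Min_le: "Min (T d) \<le> Max (T d)" if "d \<in> ?D" for d
    using V[OF that] by simp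
  obtain a b where ab: "T c = {a, b}" "a < b"
    using c(2) by (auto simp: card_2_iff) (metis insert_commute linorder_neqE_nat)
  \<comment> \<open>A two-element set consists of its minimum and maximum; their being distinct
    gives the strict inequality.\<close>
  have Tc: "T c = {j - 1 + fst c, Q c + fst c}" and "j - 1 < Q c"
    using Max[OF c(1)] Min ab by auto
  then have jQ: "j \<le> Q c" by simp
  have Qk: "Q d \<le> k" if "d \<in> ?D" for d
    using bound[OF that Max_in] V[OF that] Max[OF that] by simp
  have QR: "Q \<in> RPP lam k"
  proof -
    have "Q (s, t) \<le> Q (s, Suc t)" if "(s, t) \<in> ?D" "(s, Suc t) \<in> ?D" for s t
      using SVT_row[OF SVT that] Min_le[OF that(2)] Max[OF that(1)] Max[OF that(2)] by simp
    \<comment> \<open>Strictness down the column absorbs the increase of the row index by one,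
      leaving a weak inequality.\<close>
    moreover have "Q (s, t) \<le> Q (Suc s, t)" if "(s, t) \<in> ?D" "(Suc s, t) \<in> ?D" for s t
      using SVT_col[OF SVT that] Min_le[OF that(2)] Max[OF that(1)] Max[OF that(2)] by simp
    moreover have "Q \<in> ?D \<rightarrow>\<^sub>E {0..k}"
      by (rule PiE_I) (auto simp: Qk, simp add: Q_def)
    ultimately show ?thesis by (simp add: RPP_def)
  qed
  obtain s t where st: "c = (s, t)" by fastforce
  have "(s - 1, t) \<in> alpha lam Q j" if "s \<noteq> 1"
  proof -
    have s: "s = Suc (s - 1)" "1 \<le> s - 1" using that young_diagram_pos c(1) st by fastforce+
    then have up: "(s - 1, t) \<in> ?D" using young_diagram_up[OF lam] c(1) st by metis
    \<comment> \<open>This reads \<open>Q (s - 1, t) + (s - 1) < (j - 1) + s\<close>, which is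
      \<open>Q (s - 1, t) < j\<close> because \<open>1 \<le> j\<close>.\<close>
    have "Max (T (s - 1, t)) < Min (T c)"
      using SVT_col[OF SVT up] s c(1) st by simp
    moreover have "1 \<le> j" by (simp add: j_def)
    ultimately show ?thesis using Max[OF up] Min s up st by (auto simp: alpha_def)
  qed
  moreover have "(s, t - 1) \<in> alpha lam Q j" if "t \<noteq> 1"
  proof -
    have t: "t = Suc (t - 1)" "1 \<le> t - 1" using that young_diagram_pos c(1) st by fastforce+
    then have left: "(s, t - 1) \<in> ?D" using young_diagram_left c(1) st by metis
    have "Max (T (s, t - 1)) \<le> Min (T c)"
      using SVT_row[OF SVT left] t c(1) st by simp
    then show ?thesis using Max[OF left] Min left st by (simp add: alpha_def j_def)
  qed
  ultimately have "c \<in> proper_outside_corners lam (alpha lam Q j)"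
    using c(1) jQ st by (auto simp: proper_outside_corners_def alpha_def)
  \<comment> \<open>The bound \<open>j \<le> k\<close> comes from
    \<open>j \<le> Q c \<le> k\<close>.\<close>
  then have "(Q, j, c) \<in> corner_triples lam k"
    using QR jQ Qk[OF c(1)] by (simp add: corner_triples_def j_def)
  moreover have "T = tableau_of_triple lam (Q, j, c)"
  proof (rule extensionalityI[where A = ?D])
    show "T \<in> extensional ?D" using SVT by (auto simp: SVT_def PiE_def)
    show "tableau_of_triple lam (Q, j, c) \<in> extensional ?D" by (simp add: tableau_of_triple_def)
    fix d assume d: "d \<in> ?D"
    show "T d = tableau_of_triple lam (Q, j, c) d"
    proof (cases "d = c")
      case False
      then obtain x where "T d = {x}" using single[OF d] by (auto simp: card_1_singleton_iff)
      then show ?thesis using Max[OF d] d False by (simp add: tableau_of_triple_def)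
    qed (use d Tc in \<open>simp add: tableau_of_triple_def\<close>)
  qed
  ultimately show ?thesis by blast
qed

theorem theorem3p3:
  fixes lam :: "nat list" and k :: nat
  assumes "integer_partition lam" and "1 \<le> k"
  shows "\<exists>f. bij_betw f (BSSYT lam k)
    {(Q, j, C'). Q \<in> RPP lam k \<and> 1 \<le> j \<and> j \<le> k \<and> C' \<in> proper_outside_corners lam (alpha lam Q j)}"
proof -
  have "tableau_of_triple lam ` corner_triples lam k = BSSYT lam k"
    using tableau_of_triple_in_BSSYT BSSYT_in_image[OF assms(1)] by fast
  then have "bij_betw (tableau_of_triple lam) (corner_triples lam k) (BSSYT lam k)"
    using inj_on_tableau_of_triple by (simp add: bij_betw_def)
  \<comment> \<open>The bijection built so far runs from triples to tableaux, so its inverse is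
    taken.\<close>
  then show ?thesis
    unfolding corner_triples_def by (blast intro: bij_betw_inv_into)
qed

end
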